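(* Let $\mathbb{K}$ be an algebraically closed field of characteristic zero, let $\Gamma$ be a finite, simple, connected, undirected graph without loops with vertex set $V=\{1,\dots,n\}$, $n\ge 2$, let $\mathcal{A}\in\{\mathcal{A}_\Gamma,\mathcal{A}_{RW(\Gamma)}\}$ with natural basis $B=\{e_i\}_{i=1}^n$, let $f:\mathcal{A}\to\mathcal{A}$ be a $\mathbb{K}$-linear map, and let $\mathcal{D}\le\operatorname{Aut}(\mathcal{A})$ be the diagonal subgroup. Then $f\in\mathcal{D}$ if and only if the matrix $[f]_B$ of $f$ in the basis $B$ is a diagonal matrix, with diagonal entries $t_{11},\dots,t_{nn}$, such that: (1) $t_{ii}\in\mathbb{K}^*$ for all $i\in V$; (2) $t_{ii}^2=t_{\ell\ell}$ for all $i\in V$ and all $\ell\in\mathcal{N}(i)$; (3) for all $i\in V$, $t_{ii}$ is a cubic root of unity in $\mathbb{K}$ (i.e. $t_{ii}^3=1$).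
   Context: For $i\in V$, $\mathcal{N}(i)=\{j\in V : \{i,j\}\text{ is an edge of }\Gamma\}$ and $d_i=|\mathcal{N}(i)|$. $\mathcal{A}_\Gamma$ is the $\mathbb{K}$-algebra with basis $B=\{e_1,\dots,e_n\}$ and bilinear product determined by $e_ie_j=0$ for $i\ne j$ and $e_i^2=\sum_{k\in\mathcal{N}(i)}e_k$. $\mathcal{A}_{RW(\Gamma)}$ is the $\mathbb{K}$-algebra with basis $B=\{e_1,\dots,e_n\}$ and bilinear product determined by $e_ie_j=0$ for $i\neq j$ and $e_i^2=\frac{1}{d_i}\sum_{k\in\mathcal{N}(i)}e_k$. $\operatorname{Aut}(\mathcal{A})$ is the group of bijective $\mathbb{K}$-linear maps $f:\mathcal{A}\to\mathcal{A}$ with $f(xy)=f(x)f(y)$ for all $x,y$. The diagonal subgroup $\mathcal{D}\le\operatorname{Aut}(\mathcal{A})$ is the set of $f\in\operatorname{Aut}(\mathcal{A})$ such that for every $i\in V$, $f(e_i)=t_{ii}e_i$ for some $t_{ii}\in\mathbb{K}^*$. *)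

theory Defs
  imports "HOL-Analysis.Analysis" "HOL-Algebra.Group" "Graph_Theory.Graph_Theory"
begin

(* A finite simple graph is a pair_graph of the library: a symmetric, loop-free set parcs G of
   arcs, the two arcs (i,j) and (j,i) standing for the edge {i,j}. *)

definition neighbours :: "'n pair_pre_digraph \<Rightarrow> 'n \<Rightarrow> 'n set" where
  "neighbours G i = {j. (i, j) \<in> parcs G}"

(* The algebras live on 'k ^ 'n, with natural basis e_i = axis i 1. The product is the bilinear
   one with e_i e_i = c i and e_i e_j = 0 for distinct i, j; see evolution_mult_iff. *)

definition evolution_mult :: "('n::finite \<Rightarrow> 'k::field ^ 'n) \<Rightarrow> 'k ^ 'n \<Rightarrow> 'k ^ 'n \<Rightarrow> 'k ^ 'n" where
  "evolution_mult c x y = (\<Sum>i\<in>UNIV. (x $ i * y $ i) *s c i)"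

definition graph_mult :: "'n::finite pair_pre_digraph \<Rightarrow> 'k::field ^ 'n \<Rightarrow> 'k ^ 'n \<Rightarrow> 'k ^ 'n" where
  "graph_mult G = evolution_mult (\<lambda>i. \<Sum>k\<in>neighbours G i. axis k 1)"

definition random_walk_mult :: "'n::finite pair_pre_digraph \<Rightarrow> 'k::field ^ 'n \<Rightarrow> 'k ^ 'n \<Rightarrow> 'k ^ 'n" where
  "random_walk_mult G =
     evolution_mult (\<lambda>i. (1 / of_nat (card (neighbours G i))) *s (\<Sum>k\<in>neighbours G i. axis k 1))"

definition Aut :: "('k::field ^ 'n::finite \<Rightarrow> 'k ^ 'n \<Rightarrow> 'k ^ 'n) \<Rightarrow> ('k ^ 'n \<Rightarrow> 'k ^ 'n) monoid" where
  "Aut m = \<lparr>carrier = {f. Vector_Spaces.linear (*s) (*s) f \<and> bij f \<and> (\<forall>x y. f (m x y) = m (f x) (f y))},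
            mult = (\<circ>), one = id\<rparr>"

definition diagonal_subgroup :: "('k::field ^ 'n::finite \<Rightarrow> 'k ^ 'n \<Rightarrow> 'k ^ 'n) \<Rightarrow> ('k ^ 'n \<Rightarrow> 'k ^ 'n) set" where
  "diagonal_subgroup m =
     {f \<in> carrier (Aut m). \<forall>i. \<exists>t. t \<noteq> 0 \<and> f (axis i 1) = t *s axis i 1}"

lemma evolution_mult_iff:
  fixes m :: "'k::field ^ 'n::finite \<Rightarrow> 'k ^ 'n \<Rightarrow> 'k ^ 'n"
  shows "m = evolution_mult c \<longleftrightarrow>
    (\<forall>x. Vector_Spaces.linear (*s) (*s) (m x)) \<and>
    (\<forall>y. Vector_Spaces.linear (*s) (*s) (\<lambda>x. m x y)) \<and>
    (\<forall>i j. m (axis i 1) (axis j 1) = (if i = j then c i else 0))" (is "?L \<longleftrightarrow> ?R")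
proof -
  have lin: "Vector_Spaces.linear (*s) (*s) (evolution_mult c x)"
    "Vector_Spaces.linear (*s) (*s) (\<lambda>x. evolution_mult c x y)" for x y
    unfolding Vector_Spaces.linear_iff evolution_mult_def
    by (simp_all add: vec.vector_space_axioms vec_eq_iff algebra_simps sum.distrib sum_distrib_left)
  have basis: "evolution_mult c (axis i 1) (axis j 1) = (if i = j then c i else 0)" for i j
  proof -
    have "evolution_mult c (axis i 1) (axis j 1) = (\<Sum>k\<in>UNIV. if k = i then (if i = j then c i else 0) else 0)"
      unfolding evolution_mult_def by (rule sum.cong) (auto simp: axis_def)
    then show ?thesis by simp
  qed
  show ?thesis
  proof
    assume ?L then show ?R using lin basis by auto
  next
    assume R: ?R
    have expand: "M x y = (\<Sum>i\<in>UNIV. \<Sum>j\<in>UNIV. x $ i *s (y $ j *s M (axis i 1) (axis j 1)))"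
      if l: "\<forall>x. Vector_Spaces.linear (*s) (*s) (M x)"
        "\<forall>y. Vector_Spaces.linear (*s) (*s) (\<lambda>x. M x y)"
      for M :: "'k ^ 'n \<Rightarrow> 'k ^ 'n \<Rightarrow> 'k ^ 'n" and x y
    proof -
      have "M x y = M (\<Sum>i\<in>UNIV. x $ i *s axis i 1) y" by (simp add: basis_expansion)
      also have "\<dots> = (\<Sum>i\<in>UNIV. x $ i *s M (axis i 1) y)"
        by (simp only: vec.linear_sum[OF l(2)[rule_format, of y]] vec.linear_scale[OF l(2)[rule_format, of y]])
      also have "\<dots> = (\<Sum>i\<in>UNIV. x $ i *s (\<Sum>j\<in>UNIV. y $ j *s M (axis i 1) (axis j 1)))"
      proof (intro sum.cong refl arg_cong[where f = "\<lambda>v. _ *s v"])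
        fix i
        have "M (axis i 1) y = M (axis i 1) (\<Sum>j\<in>UNIV. y $ j *s axis j 1)" by (simp add: basis_expansion)
        then show "M (axis i 1) y = (\<Sum>j\<in>UNIV. y $ j *s M (axis i 1) (axis j 1))"
          by (simp only: vec.linear_sum[OF l(1)[rule_format]] vec.linear_scale[OF l(1)[rule_format]])
      qed
      finally show ?thesis by (simp add: vec.scale_sum_right)
    qed
    have "m x y = evolution_mult c x y" for x y
      using expand[of m x y] expand[of "evolution_mult c" x y] R lin basis by simp
    then show ?L by blast
  qed
qed

lemma group_Aut: "group (Aut m)"
proof (rule groupI)
  fix f assume f: "f \<in> carrier (Aut m)"
  then have b: "bij f" and l: "Vector_Spaces.linear (*s) (*s) f" and mm: "\<And>x y. f (m x y) = m (f x) (f y)"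
    by (auto simp: Aut_def)
  have r: "f (inv_into UNIV f x) = x" "inv_into UNIV f (f x) = x" for x
    using b by (auto simp: bij_def surj_f_inv_f)
  have "Vector_Spaces.linear (*s) (*s) (inv_into UNIV f)"
    unfolding Vector_Spaces.linear_iff
  proof (intro conjI allI vec.vector_space_axioms)
    show "inv_into UNIV f (x + y) = inv_into UNIV f x + inv_into UNIV f y" for x y
      using r(2)[of "inv_into UNIV f x + inv_into UNIV f y"] r(1) vec.linear_add[OF l] by simp
    show "inv_into UNIV f (c *s x) = c *s inv_into UNIV f x" for c x
      using r(2)[of "c *s inv_into UNIV f x"] r(1) vec.linear_scale[OF l] by simp
  qed
  moreover have "inv_into UNIV f (m x y) = m (inv_into UNIV f x) (inv_into UNIV f y)" for x y by (metis mm r)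
  ultimately have "inv_into UNIV f \<in> carrier (Aut m)" using b by (auto simp: Aut_def bij_imp_bij_inv)
  moreover have "inv_into UNIV f \<circ> f = id" using r by auto
  ultimately show "\<exists>g\<in>carrier (Aut m). g \<otimes>\<^bsub>Aut m\<^esub> f = \<one>\<^bsub>Aut m\<^esub>" by (auto simp: Aut_def)
qed (auto simp: Aut_def bij_comp vec.linear_id Vector_Spaces.linear_compose comp_assoc)

lemma subgroup_diagonal: "subgroup (diagonal_subgroup m) (Aut m)"
proof (rule group.subgroupI[OF group_Aut])
  show "diagonal_subgroup m \<subseteq> carrier (Aut m)" by (auto simp: diagonal_subgroup_def)
  have "\<one>\<^bsub>Aut m\<^esub> \<in> diagonal_subgroup m"
    using group.is_monoid[OF group_Aut, of m, THEN monoid.one_closed]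
    by (auto simp: diagonal_subgroup_def Aut_def intro!: exI[of _ 1])
  then show "diagonal_subgroup m \<noteq> {}" by blast
next
  fix f assume f: "f \<in> diagonal_subgroup m"
  define g where "g = inv\<^bsub>Aut m\<^esub> f"
  have fc: "f \<in> carrier (Aut m)" using f by (simp add: diagonal_subgroup_def)
  have gc: "g \<in> carrier (Aut m)" unfolding g_def by (rule group.inv_closed[OF group_Aut fc])
  have "g \<circ> f = id" using group.l_inv[OF group_Aut fc] by (simp add: g_def Aut_def)
  then have gf: "g (f x) = x" for x by (metis comp_apply id_apply)
  have "\<exists>t. t \<noteq> 0 \<and> g (axis i 1) = t *s axis i 1" for i
  proof -
    obtain t where t: "t \<noteq> 0" "f (axis i 1) = t *s axis i 1"
      using f by (auto simp: diagonal_subgroup_def)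
    have "t *s g (axis i 1) = axis i 1"
      using gf[of "axis i 1"] t vec.linear_scale[of g t "axis i 1"] gc by (simp add: Aut_def)
    then have "inverse t *s (t *s g (axis i 1)) = inverse t *s axis i 1" by simp
    then show ?thesis using t by (intro exI[of _ "inverse t"]) (simp add: vector_smult_assoc)
  qed
  then show "inv\<^bsub>Aut m\<^esub> f \<in> diagonal_subgroup m" using gc by (simp add: diagonal_subgroup_def g_def)
next
  fix f g assume fg: "f \<in> diagonal_subgroup m" "g \<in> diagonal_subgroup m"
  have c: "f \<circ> g \<in> carrier (Aut m)"
    using group.is_monoid[OF group_Aut, of m, THEN monoid.m_closed, of f g] fg
    by (simp add: diagonal_subgroup_def Aut_def)
  have "\<exists>t. t \<noteq> 0 \<and> (f \<circ> g) (axis i 1) = t *s axis i 1" for i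
  proof -
    obtain s t where "s \<noteq> 0" "f (axis i 1) = s *s axis i 1" "t \<noteq> 0" "g (axis i 1) = t *s axis i 1"
      using fg unfolding diagonal_subgroup_def by blast
    then show ?thesis using vec.linear_scale[of f t "axis i 1"] fg
      by (intro exI[of _ "t * s"]) (simp add: diagonal_subgroup_def Aut_def vector_smult_assoc)
  qed
  then show "f \<otimes>\<^bsub>Aut m\<^esub> g \<in> diagonal_subgroup m" using c by (simp add: diagonal_subgroup_def Aut_def)
qed

end

theory Submission
  imports Defs
begin

text \<open>For a linear \<open>f\<close> with \<open>f e_i = t_i e_i\<close>, comparing the
  \<open>e_k\<close>-coordinates of \<open>f(e_i e_i)\<close> and \<open>f(e_i) f(e_i)\<close> gives
  \<open>t_k c_ik = t_i^2 c_ik\<close>, where \<open>c_ik\<close> are the structure constants. In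
  both algebras \<open>c_ik\<close> is nonzero exactly when \<open>k\<close> is a neighbour of
  \<open>i\<close>, so its value cancels and multiplicativity becomes condition (2); bijectivity is
  condition (1). Condition (3) follows from these: every vertex has a neighbour, and crossing an
  edge and returning yields \<open>t_i = t_i^4\<close>. The general criterion is
  \<open>mem_diagonal_subgroup_iff\<close>; \<open>graph_mult_weighted\<close> brings both algebras
  under it.\<close>

lemma neighbours_sym:
  assumes "pair_graph G" "j \<in> neighbours G i"
  shows "i \<in> neighbours G j"
proof -
  interpret pair_graph G by fact
  show ?thesis
    using assms(2) sym_arcs by (auto simp: neighbours_def symmetric_def sym_def)
qed

text \<open>With at least two vertices, a path from \<open>i\<close> to another vertex must have a
  first arc, which leaves \<open>i\<close>.\<close>

lemma neighbours_nonempty: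
  fixes G :: "'n::finite pair_pre_digraph"
  assumes "pair_graph G" "pverts G = UNIV" "CARD('n) \<ge> 2"
    and "Digraph_Component.connected (with_proj G)"
  shows "neighbours G i \<noteq> {}"
proof -
  have "UNIV \<noteq> {i}"
  proof
    assume "UNIV = {i}"
    then have "CARD('n) = card {i}" by (rule arg_cong)
    with assms(3) show False by simp
  qed
  then obtain j where "j \<noteq> i" by auto
  \<comment> \<open>Connectedness is strong connectedness of the symmetric closure, so an arc found
    there may come from either direction in \<open>G\<close>; symmetry of \<open>G\<close> settles
    this below.\<close>
  have "i \<rightarrow>\<^sup>*\<^bsub>with_proj (mk_symmetric (with_proj G))\<^esub> j"
    using assms(2,4)
    by (auto simp: Digraph_Component.connected_def strongly_connected_def mk_symmetric_def)
  then obtain k where "(i, k) \<in> parcs (mk_symmetric (with_proj G))"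
    using \<open>j \<noteq> i\<close> by (auto elim: pre_digraph.converse_reachable_cases)
  then have "k \<in> neighbours G i \<or> i \<in> neighbours G k"
    by (auto simp: mk_symmetric_def neighbours_def)
  with neighbours_sym[OF assms(1)] show ?thesis by blast
qed

lemma axis_component: "axis i a $ j = (if j = i then a else 0)"
  by (simp add: axis_def)

lemma sum_axis_component:
  fixes l :: "'n::finite"
  shows "(\<Sum>k\<in>S. axis k (1::'k::semiring_1) $ l) = (if l \<in> S then 1 else 0)"
  by (simp add: axis_component)

text \<open>Treats both algebras at once, with weight \<open>1\<close> or \<open>1/d_i\<close>. The
  latter is nonzero because \<open>d_i\<close> is positive and the characteristic is zero.\<close>

lemma graph_mult_weighted:
  fixes m :: "'k::field_char_0 ^ 'n::finite \<Rightarrow> 'k ^ 'n \<Rightarrow> 'k ^ 'n"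
  assumes "m \<in> {graph_mult G, random_walk_mult G}" and "\<And>i. neighbours G i \<noteq> {}"
  obtains w where "\<And>i. w i \<noteq> 0"
    "m = evolution_mult (\<lambda>i. w i *s (\<Sum>k\<in>neighbours G i. axis k 1))"
proof (cases "m = graph_mult G")
  case True
  then show ?thesis
    using that[of "\<lambda>_. 1"] by (simp add: graph_mult_def)
next
  case False
  then have "m = random_walk_mult G" using assms(1) by simp
  moreover have "card (neighbours G i) \<noteq> 0" for i
    using assms(2) by (simp add: card_eq_0_iff)
  ultimately show ?thesis
    using that[of "\<lambda>i. 1 / of_nat (card (neighbours G i))"] by (simp add: random_walk_mult_def)
qed

lemma linear_diagonal_apply:
  fixes f :: "'k::field ^ 'n::finite \<Rightarrow> 'k ^ 'n"
  assumes "Vector_Spaces.linear (*s) (*s) f" and "\<And>i. f (axis i 1) = t i *s axis i 1"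
  shows "f x $ i = t i * x $ i"
proof -
  have "f x = f (\<Sum>j\<in>UNIV. x $ j *s axis j 1)" by (simp add: basis_expansion)
  also have "\<dots> = (\<Sum>j\<in>UNIV. x $ j *s f (axis j 1))"
    by (simp only: vec.linear_sum[OF assms(1)] vec.linear_scale[OF assms(1)])
  finally have "f x $ i = (\<Sum>j\<in>UNIV. x $ j * (t j * axis j 1 $ i))"
    by (simp add: assms(2) mult.assoc)
  also have "\<dots> = (\<Sum>j\<in>UNIV. if j = i then x $ i * t i else 0)"
    by (rule sum.cong) (auto simp: axis_component)
  finally show ?thesis by (simp add: mult.commute)
qed

text \<open>Squares of basis vectors suffice as tests: in any product the \<open>i\<close>-th
  summand is a multiple of \<open>c i\<close>, and its \<open>k\<close>-th coordinate gets the
  factor \<open>t k\<close> on one side and \<open>(t i)^2\<close> on the other.\<close>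

lemma diagonal_multiplicative_iff:
  fixes f :: "'k::field ^ 'n::finite \<Rightarrow> 'k ^ 'n"
  assumes "\<And>x i. f x $ i = t i * x $ i"
  shows "(\<forall>x y. f (evolution_mult c x y) = evolution_mult c (f x) (f y)) \<longleftrightarrow>
    (\<forall>i k. t k * c i $ k = (t i)\<^sup>2 * c i $ k)" (is "?L \<longleftrightarrow> ?R")
proof
  assume ?L
  \<comment> \<open>The scalar \<open>a\<close> is kept general: \<open>a = 1\<close> gives the
    square of \<open>e_i\<close>, and \<open>a = t i\<close> the square of its image.\<close>
  have basis: "evolution_mult c (a *s axis i 1) (a *s axis i 1) $ k = a\<^sup>2 * c i $ k" for a i k
  proof -
    have "evolution_mult c (a *s axis i 1) (a *s axis i 1) $ k =
        (\<Sum>j\<in>UNIV. (a * axis i 1 $ j) * (a * axis i 1 $ j) * c j $ k)"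
      by (simp add: evolution_mult_def)
    also have "\<dots> = (\<Sum>j\<in>UNIV. if j = i then a\<^sup>2 * c i $ k else 0)"
      by (rule sum.cong) (auto simp: axis_component power2_eq_square)
    finally show ?thesis by simp
  qed
  have f_axis: "f (axis i 1) = t i *s axis i 1" for i
    by (simp add: vec_eq_iff assms axis_component)
  show ?R
  proof (intro allI)
    fix i k
    show "t k * c i $ k = (t i)\<^sup>2 * c i $ k"
      using arg_cong[OF \<open>?L\<close>[rule_format, of "axis i 1" "axis i 1"], of "\<lambda>v. v $ k"]
        basis[of 1 i k] basis[of "t i" i k] by (simp add: assms f_axis)
  qed
next
  assume ?R
  show ?L
  proof (intro allI, simp add: vec_eq_iff evolution_mult_def assms sum_distrib_left, intro allI sum.cong refl)
    fix x y k i
    show "t k * (x $ i * y $ i * c i $ k) = t i * x $ i * (t i * y $ i) * c i $ k"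
      using \<open>?R\<close>[rule_format, of k i] by (simp add: power2_eq_square algebra_simps)
  qed
qed

text \<open>Column \<open>i\<close> of \<open>matrix f\<close> is \<open>f e_i\<close>, so vanishing
  off the diagonal says that each \<open>e_i\<close> is an eigenvector.\<close>

lemma mem_diagonal_subgroup_iff:
  fixes f :: "'k::field ^ 'n::finite \<Rightarrow> 'k ^ 'n"
  assumes lin: "Vector_Spaces.linear (*s) (*s) f"
  shows "f \<in> diagonal_subgroup (evolution_mult c) \<longleftrightarrow>
    (\<forall>i j. i \<noteq> j \<longrightarrow> matrix f $ i $ j = 0) \<and>
    (\<forall>i. matrix f $ i $ i \<noteq> 0) \<and>
    (\<forall>i k. matrix f $ k $ k * c i $ k = (matrix f $ i $ i)\<^sup>2 * c i $ k)" (is "?L \<longleftrightarrow> ?R")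
proof
  assume ?L
  then have mult: "\<forall>x y. f (evolution_mult c x y) = evolution_mult c (f x) (f y)"
    and "\<forall>i. \<exists>t. t \<noteq> 0 \<and> f (axis i 1) = t *s axis i 1"
    by (simp_all add: diagonal_subgroup_def Aut_def)
  then obtain t where t: "\<And>i. t i \<noteq> 0" "\<And>i. f (axis i 1) = t i *s axis i 1" by metis
  have "matrix f $ i $ j = (if i = j then t i else 0)" for i j
    by (simp add: matrix_def t(2) axis_component)
  then show ?R
    using t(1) mult diagonal_multiplicative_iff[OF linear_diagonal_apply[OF lin t(2)], of c] by simp
next
  assume R: ?R
  define t where "t i = matrix f $ i $ i" for i
  have axis: "f (axis i 1) = t i *s axis i 1" for i
    using R by (auto simp: vec_eq_iff t_def matrix_def axis_def)
  note app = linear_diagonal_apply[OF lin axis]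
  have t: "t i \<noteq> 0" for i using R by (simp add: t_def)
  have "bij f"
  proof (rule o_bij)
    \<comment> \<open>The inverse divides each coordinate by its eigenvalue.\<close>
    show "(\<lambda>x. \<chi> i. x $ i / t i) \<circ> f = id" "f \<circ> (\<lambda>x. \<chi> i. x $ i / t i) = id"
      using t by (auto simp: fun_eq_iff vec_eq_iff app)
  qed
  moreover have "\<forall>x y. f (evolution_mult c x y) = evolution_mult c (f x) (f y)"
    using R diagonal_multiplicative_iff[OF app, of c] by (simp add: t_def)
  ultimately show ?L
    using lin axis t by (auto simp: diagonal_subgroup_def Aut_def)
qed

theorem proposition2p5:
  fixes G :: "'n::finite pair_pre_digraph"
    and m :: "'k::{alg_closed_field, field_char_0} ^ 'n \<Rightarrow> 'k ^ 'n \<Rightarrow> 'k ^ 'n"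
    and f :: "'k ^ 'n \<Rightarrow> 'k ^ 'n"
  assumes "pair_graph G"
    and "pverts G = UNIV"
    and "CARD('n) \<ge> 2"
    and "Digraph_Component.connected (with_proj G)"
    and "m \<in> {graph_mult G, random_walk_mult G}"
    and "Vector_Spaces.linear (*s) (*s) f"
  shows "f \<in> diagonal_subgroup m \<longleftrightarrow>
    (\<forall>i j. i \<noteq> j \<longrightarrow> matrix f $ i $ j = 0) \<and>
    (\<forall>i. matrix f $ i $ i \<noteq> 0) \<and>
    (\<forall>i. \<forall>l\<in>neighbours G i. (matrix f $ i $ i)\<^sup>2 = matrix f $ l $ l) \<and>
    (\<forall>i. (matrix f $ i $ i) ^ 3 = 1)"
proof -
  have nonempty: "neighbours G i \<noteq> {}" for i
    using assms(1-4) by (rule neighbours_nonempty)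
  obtain w :: "'n \<Rightarrow> 'k" where w: "\<And>i. w i \<noteq> 0"
    and m: "m = evolution_mult (\<lambda>i. w i *s (\<Sum>k\<in>neighbours G i. axis k 1))"
    using graph_mult_weighted[OF assms(5) nonempty] by blast
  define t where "t i = matrix f $ i $ i" for i
  have cube: "t i ^ 3 = 1"
    if nz: "\<And>i. t i \<noteq> 0" and sq: "\<And>i l. l \<in> neighbours G i \<Longrightarrow> (t i)\<^sup>2 = t l" for i
  proof -
    obtain l where l: "l \<in> neighbours G i" using nonempty by blast
    \<comment> \<open>Apply the squaring relation along the edge from \<open>i\<close> to
      \<open>l\<close>, then back.\<close>
    have "t i = ((t i)\<^sup>2)\<^sup>2"
      using sq[OF l] sq[OF neighbours_sym[OF assms(1) l]] by simp
    then have "t i * t i ^ 3 = t i * 1"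
      by (simp add: power2_eq_square power3_eq_cube mult.assoc)
    then show ?thesis using nz[of i] by simp
  qed
  \<comment> \<open>The \<open>k\<close>-th coordinate of the square of \<open>e_i\<close> is
    \<open>w i\<close> for neighbours \<open>k\<close> and \<open>0\<close> otherwise, so only
    neighbours impose a relation and \<open>w i\<close> cancels.\<close>
  have "f \<in> diagonal_subgroup m \<longleftrightarrow>
    (\<forall>i j. i \<noteq> j \<longrightarrow> matrix f $ i $ j = 0) \<and> (\<forall>i. t i \<noteq> 0) \<and>
    (\<forall>i. \<forall>l\<in>neighbours G i. (t i)\<^sup>2 = t l)"
    unfolding m mem_diagonal_subgroup_iff[OF assms(6)] t_def[symmetric]
    by (auto simp: sum_axis_component w)
  then show ?thesis unfolding t_def[symmetric] by (auto intro: cube)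
qed

end
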